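(* Let $(P,\le)$ be a poset, let $\Theta,\Phi$ be congruences on $(P,\le)$, and let $a,b\in P$ with $(a,b)\in\Theta$. Then: (i) there exist some $u\in\operatorname{Max}L(a,b)$ and some $v\in\operatorname{Min}U(a,b)$ with $u,v\in[a]\Theta$; (ii) $[a]\Theta$ is convex, i.e. if $x,z\in[a]\Theta$, $y\in P$ and $x\le y\le z$, then $y\in[a]\Theta$; (iii) for all $c,d\in P$: $(c,d)\in\Theta$ if and only if there exists some $(e,f)\in\Theta$ with $c,d\in[e,f]$, where $[e,f]=\{x\in P\mid e\le x\le f\}$; (iv) $\Theta=\Phi$ if and only if $\Theta\cap\{(x,y)\in P^2\mid x\le y\}=\Phi\cap\{(x,y)\in P^2\mid x\le y\}$.
   Context: For a poset $(P,\le)$ and $x,y\in P$ let $L(x,y)=\{z\in P\mid z\le x,\ z\le y\}$ and $U(x,y)=\{z\in P\mid x\le z,\ y\le z\}$; for $A\subseteq P$, $\operatorname{Max}A$ and $\operatorname{Min}A$ denote the sets of maximal and minimal elements of $A$. A binary operator on $P$ is a map $Q\colon P^2\to 2^P$; a binary relation $R$ on $P$ is compatible with $Q$ if whenever $(a_1,b_1),(a_2,b_2)\in R$ there exist $a\in Q(a_1,a_2)$ and $b\in Q(b_1,b_2)$ with $(a,b)\in R$. A congruence on $(P,\le)$ is an equivalence relation on $P$ compatible with both binary operators $(x,y)\mapsto\operatorname{Max}L(x,y)$ and $(x,y)\mapsto\operatorname{Min}U(x,y)$. $[a]\Theta$ denotes the class of $a$ under $\Theta$. *)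

theory Defs
  imports Main
begin

text \<open>
  A poset is a type of class \<open>order\<close>; the class \<open>[a]\<Theta>\<close> is the relational image \<open>\<Theta> `` {a}\<close>.
\<close>

definition lower_cone :: "'a::order \<Rightarrow> 'a \<Rightarrow> 'a set" where
  "lower_cone x y = {z. z \<le> x \<and> z \<le> y}"

definition upper_cone :: "'a::order \<Rightarrow> 'a \<Rightarrow> 'a set" where
  "upper_cone x y = {z. x \<le> z \<and> y \<le> z}"

definition maximal_elems :: "'a::order set \<Rightarrow> 'a set" where
  "maximal_elems A = {m \<in> A. \<not> (\<exists>x\<in>A. m < x)}"

definition minimal_elems :: "'a::order set \<Rightarrow> 'a set" where
  "minimal_elems A = {m \<in> A. \<not> (\<exists>x\<in>A. x < m)}"

definition compatible_with :: "('a \<times> 'a) set \<Rightarrow> ('a \<Rightarrow> 'a \<Rightarrow> 'a set) \<Rightarrow> bool" where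
  "compatible_with R Q \<longleftrightarrow>
     (\<forall>a1 b1 a2 b2. (a1, b1) \<in> R \<longrightarrow> (a2, b2) \<in> R \<longrightarrow>
        (\<exists>a \<in> Q a1 a2. \<exists>b \<in> Q b1 b2. (a, b) \<in> R))"

definition poset_congruence :: "('a::order \<times> 'a) set \<Rightarrow> bool" where
  "poset_congruence \<Theta> \<longleftrightarrow>
     equiv UNIV \<Theta> \<and>
     compatible_with \<Theta> (\<lambda>x y. maximal_elems (lower_cone x y)) \<and>
     compatible_with \<Theta> (\<lambda>x y. minimal_elems (upper_cone x y))"

end

theory Submission
  imports Defs
begin

text \<open>
  For comparable elements \<open>x \<le> y\<close> the sets \<open>Max L(x,y)\<close> and \<open>Min U(x,y)\<close> are singletons, so
  compatibility behaves as for lattice congruences. Pairing \<open>(a,a)\<close> with \<open>(b,a)\<close> yields (i);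
  pairing \<open>(x,z)\<close> with \<open>(y,y)\<close> for \<open>x \<le> y \<le> z\<close> yields (ii). Hence a congruence is the set of
  pairs lying in a common interval with congruent endpoints, so it is determined by its
  restriction to \<open>\<le>\<close>.
\<close>

lemma maximal_elems_lower_cone_le: "x \<le> y \<Longrightarrow> maximal_elems (lower_cone x y) = {x}"
  by (auto simp: maximal_elems_def lower_cone_def order_le_less)

lemma maximal_elems_lower_cone_ge: "y \<le> x \<Longrightarrow> maximal_elems (lower_cone x y) = {y}"
  by (auto simp: maximal_elems_def lower_cone_def order_le_less)

lemma minimal_elems_upper_cone_le: "x \<le> y \<Longrightarrow> minimal_elems (upper_cone x y) = {y}"
  by (auto simp: minimal_elems_def upper_cone_def order_le_less)

lemma compatible_withD:
  assumes "compatible_with R Q" "(a1, b1) \<in> R" "(a2, b2) \<in> R"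
  shows "\<exists>a \<in> Q a1 a2. \<exists>b \<in> Q b1 b2. (a, b) \<in> R"
  using assms unfolding compatible_with_def by blast

context
  fixes \<Theta> :: "('a::order \<times> 'a) set"
  assumes cong: "poset_congruence \<Theta>"
begin

lemma poset_congruence_refl: "(x, x) \<in> \<Theta>"
  using cong by (auto simp: poset_congruence_def equiv_def refl_on_def)

lemma poset_congruence_sym: "(x, y) \<in> \<Theta> \<Longrightarrow> (y, x) \<in> \<Theta>"
  using cong by (auto simp: poset_congruence_def equiv_def dest: symD)

lemma poset_congruence_trans: "(x, y) \<in> \<Theta> \<Longrightarrow> (y, z) \<in> \<Theta> \<Longrightarrow> (x, z) \<in> \<Theta>"
  using cong by (auto simp: poset_congruence_def equiv_def dest: transD)

text \<open>Compatibility applied to \<open>(a, a)\<close> and \<open>(b, a)\<close> relates some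
  element of Max L(a,b) to an element of Max L(a,a). The latter set is just \<open>{a}\<close>, so
  no choice remains on that side.\<close>

lemma poset_congruence_meet:
  assumes "(a, b) \<in> \<Theta>"
  shows "\<exists>u \<in> maximal_elems (lower_cone a b). (a, u) \<in> \<Theta>"
proof -
  have "compatible_with \<Theta> (\<lambda>x y. maximal_elems (lower_cone x y))"
    using cong by (simp add: poset_congruence_def)
  from compatible_withD [OF this poset_congruence_refl [of a] poset_congruence_sym [OF assms]]
  show ?thesis
    by (auto simp: maximal_elems_lower_cone_le intro: poset_congruence_sym)
qed

lemma poset_congruence_join:
  assumes "(a, b) \<in> \<Theta>"
  shows "\<exists>v \<in> minimal_elems (upper_cone a b). (a, v) \<in> \<Theta>"
proof -
  have "compatible_with \<Theta> (\<lambda>x y. minimal_elems (upper_cone x y))"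
    using cong by (simp add: poset_congruence_def)
  from compatible_withD [OF this poset_congruence_refl [of a] poset_congruence_sym [OF assms]]
  show ?thesis
    by (auto simp: minimal_elems_upper_cone_le intro: poset_congruence_sym)
qed

text \<open>With \<open>(x, z)\<close> and \<open>(y, y)\<close> both sets of maximal lower bounds
  collapse: Max L(x,y) is \<open>{x}\<close> and Max L(z,y) is \<open>{y}\<close>, so the only pair
  that compatibility can provide is \<open>(x, y)\<close>.\<close>

lemma poset_congruence_convex:
  assumes "(x, z) \<in> \<Theta>" "x \<le> y" "y \<le> z"
  shows "(x, y) \<in> \<Theta>"
proof -
  have "compatible_with \<Theta> (\<lambda>x y. maximal_elems (lower_cone x y))"
    using cong by (simp add: poset_congruence_def)
  from compatible_withD [OF this assms(1) poset_congruence_refl [of y]]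
  show ?thesis
    using assms(2,3) by (simp add: maximal_elems_lower_cone_le maximal_elems_lower_cone_ge)
qed

lemma poset_congruence_iff_interval:
  "(c, d) \<in> \<Theta> \<longleftrightarrow> (\<exists>e f. (e, f) \<in> \<Theta> \<and> c \<in> {e..f} \<and> d \<in> {e..f})"
proof
  assume cd: "(c, d) \<in> \<Theta>"
  obtain e where "e \<in> lower_cone c d" "(c, e) \<in> \<Theta>"
    using poset_congruence_meet [OF cd] by (auto simp: maximal_elems_def)
  moreover obtain f where "f \<in> upper_cone c d" "(c, f) \<in> \<Theta>"
    using poset_congruence_join [OF cd] by (auto simp: minimal_elems_def)
  \<comment> \<open>The endpoints are a maximal lower and a minimal upper bound of \<open>c\<close>
    and \<open>d\<close>; they are congruent because each is congruent to \<open>c\<close>.\<close>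
  ultimately have "(e, f) \<in> \<Theta>" "c \<in> {e..f}" "d \<in> {e..f}"
    using poset_congruence_trans [OF poset_congruence_sym, of c e f]
    by (auto simp: lower_cone_def upper_cone_def)
  then show "\<exists>e f. (e, f) \<in> \<Theta> \<and> c \<in> {e..f} \<and> d \<in> {e..f}"
    by blast
next
  assume "\<exists>e f. (e, f) \<in> \<Theta> \<and> c \<in> {e..f} \<and> d \<in> {e..f}"
  then obtain e f where "(e, f) \<in> \<Theta>" "c \<in> {e..f}" "d \<in> {e..f}"
    by blast
  \<comment> \<open>By convexity the lower endpoint \<open>e\<close> is congruent to every element
    of the interval, so it links \<open>c\<close> to \<open>d\<close>.\<close>
  then have "(e, c) \<in> \<Theta>" "(e, d) \<in> \<Theta>"
    using poset_congruence_convex [of e f] by auto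
  then show "(c, d) \<in> \<Theta>"
    by (rule poset_congruence_trans [OF poset_congruence_sym])
qed

end

text \<open>Each pair of \<Theta> lies in an interval with congruent endpoints. The endpoints are
  comparable, so they pass to \<Phi>, and the interval criterion for \<Phi> recovers the
  pair.\<close>

lemma poset_congruence_subset_if_order_subset:
  assumes "poset_congruence \<Theta>" "poset_congruence \<Phi>"
    and "\<Theta> \<inter> {(x, y). x \<le> y} \<subseteq> \<Phi>"
  shows "\<Theta> \<subseteq> \<Phi>"
proof (rule subrelI)
  fix c d
  assume "(c, d) \<in> \<Theta>"
  then obtain e f where ef: "(e, f) \<in> \<Theta>" "c \<in> {e..f}" "d \<in> {e..f}"
    using poset_congruence_iff_interval [OF assms(1)] by blast
  \<comment> \<open>The interval contains \<open>c\<close>, hence is nonempty.\<close>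
  then have "e \<le> f"
    by auto
  with ef(1) assms(3) have "(e, f) \<in> \<Phi>"
    by blast
  with ef show "(c, d) \<in> \<Phi>"
    using poset_congruence_iff_interval [OF assms(2)] by blast
qed

theorem theorem3p2:
  fixes \<Theta> \<Phi> :: "('a::order \<times> 'a) set" and a b :: 'a
  assumes "poset_congruence \<Theta>" and "poset_congruence \<Phi>" and "(a, b) \<in> \<Theta>"
  shows "(\<exists>u \<in> maximal_elems (lower_cone a b). \<exists>v \<in> minimal_elems (upper_cone a b).
            u \<in> \<Theta> `` {a} \<and> v \<in> \<Theta> `` {a}) \<and>
         (\<forall>x y z. x \<in> \<Theta> `` {a} \<longrightarrow> z \<in> \<Theta> `` {a} \<longrightarrow> x \<le> y \<longrightarrow> y \<le> z \<longrightarrow> y \<in> \<Theta> `` {a}) \<and>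
         (\<forall>c d. (c, d) \<in> \<Theta> \<longleftrightarrow> (\<exists>e f. (e, f) \<in> \<Theta> \<and> c \<in> {e..f} \<and> d \<in> {e..f})) \<and>
         (\<Theta> = \<Phi> \<longleftrightarrow> \<Theta> \<inter> {(x, y). x \<le> y} = \<Phi> \<inter> {(x, y). x \<le> y})"
proof (intro conjI)
  show "\<exists>u \<in> maximal_elems (lower_cone a b). \<exists>v \<in> minimal_elems (upper_cone a b).
          u \<in> \<Theta> `` {a} \<and> v \<in> \<Theta> `` {a}"
    using poset_congruence_meet [OF assms(1,3)] poset_congruence_join [OF assms(1,3)] by blast
  show "\<forall>x y z. x \<in> \<Theta> `` {a} \<longrightarrow> z \<in> \<Theta> `` {a} \<longrightarrow> x \<le> y \<longrightarrow> y \<le> z \<longrightarrow> y \<in> \<Theta> `` {a}"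
  proof (intro allI impI)
    fix x y z
    assume "x \<in> \<Theta> `` {a}" "z \<in> \<Theta> `` {a}" "x \<le> y" "y \<le> z"
    \<comment> \<open>Convexity needs the ends \<open>x\<close> and \<open>z\<close> congruent to
      each other; this is obtained through \<open>a\<close>.\<close>
    then have ax: "(a, x) \<in> \<Theta>" and "(x, z) \<in> \<Theta>"
      using poset_congruence_trans [OF assms(1) poset_congruence_sym [OF assms(1)], of a x z]
      by auto
    then have "(x, y) \<in> \<Theta>"
      using poset_congruence_convex [OF assms(1)] \<open>x \<le> y\<close> \<open>y \<le> z\<close> by blast
    with ax show "y \<in> \<Theta> `` {a}"
      using poset_congruence_trans [OF assms(1)] by blast
  qed
  show "\<forall>c d. (c, d) \<in> \<Theta> \<longleftrightarrow> (\<exists>e f. (e, f) \<in> \<Theta> \<and> c \<in> {e..f} \<and> d \<in> {e..f})"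
    using poset_congruence_iff_interval [OF assms(1)] by blast
  show "\<Theta> = \<Phi> \<longleftrightarrow> \<Theta> \<inter> {(x, y). x \<le> y} = \<Phi> \<inter> {(x, y). x \<le> y}"
    using poset_congruence_subset_if_order_subset [OF assms(1,2)]
      poset_congruence_subset_if_order_subset [OF assms(2,1)] by blast
qed

end
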